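(* Let $A\in\mathbb{R}^{m\times n}$, and let $F$, $S$, $\kappa(A)$ and $\Phi$ be the objects associated with $A$ as defined in the context. Assume that $(\Delta_m\times\Delta_n)\setminus S\neq\emptyset$. Then $$\kappa(A)=\sup_{(x,y)\in(\Delta_m\times\Delta_n)\setminus S}\operatorname{reg}\Phi\big((x,y),F(x,y)\big).$$
   Context: All norms are Euclidean and $\operatorname{dist}(\cdot\,;C)$ is the Euclidean distance to a set $C$, with $\operatorname{dist}(\cdot\,;\emptyset)=\infty$ (convention $\inf\emptyset=\infty$). $\Delta_m=\{x\in\mathbb{R}^m : \sum_{i=1}^m x_i=1,\ x\ge 0\}$, and similarly $\Delta_n\subset\mathbb{R}^n$. For $(x,y)\in\mathbb{R}^m\times\mathbb{R}^n$ let $$F(x,y):=\max\{x^{T}Av-u^{T}Ay : (u,v)\in\Delta_m\times\Delta_n\}.$$ One has $\min_{\Delta_m\times\Delta_n}F=0$. The set of Nash equilibria is $S:=\{(x,y)\in\Delta_m\times\Delta_n : F(x,y)=0\}$. The condition measure of $A$ is $$\kappa(A):=\inf\{\kappa\ge 0 : \operatorname{dist}((x,y);S)\le\kappa F(x,y)\ \text{for all }(x,y)\in\Delta_m\times\Delta_n\}.$$ The set-valued mapping $\Phi:\mathbb{R}^{m+n}\rightrightarrows\mathbb{R}$ is defined by $\Phi(x,y):=[F(x,y),\infty)$ if $(x,y)\in\Delta_m\times\Delta_n$, and $\Phi(x,y):=\emptyset$ otherwise. Metric regularity: for a set-valued mapping $G:\mathbb{R}^p\rightrightarrows\mathbb{R}^q$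 with inverse $G^{-1}(z)=\{x : z\in G(x)\}$ and a point $(\bar x,\bar z)$ with $\bar z\in G(\bar x)$, $G$ is metrically regular around $(\bar x,\bar z)$ with modulus $\mu\ge0$ if there are neighborhoods $U$ of $\bar x$ and $V$ of $\bar z$ such that $\operatorname{dist}(x;G^{-1}(z))\le\mu\operatorname{dist}(z;G(x))$ for all $x\in U$, $z\in V$. The exact regularity bound $\operatorname{reg}G(\bar x,\bar z)$ is the infimum of $\mu\ge 0$ over all $(\mu,U,V)$ for which this holds. *)

theory Defs
  imports "HOL-Analysis.Analysis"
begin

text \<open>The value is taken in \<^typ>\<open>ereal\<close>, so that the distance to the empty set is \<open>\<infinity>\<close>;
  the library's \<^const>\<open>infdist\<close> yields 0 there.\<close>

definition edist_to :: "'a::metric_space \<Rightarrow> 'a set \<Rightarrow> ereal" where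
  "edist_to x C = (INF c\<in>C. ereal (dist x c))"

definition set_valued_inverse :: "('a \<Rightarrow> 'b set) \<Rightarrow> 'b \<Rightarrow> 'a set" where
  "set_valued_inverse G z = {x. z \<in> G x}"

text \<open>The product \<open>0 * \<infinity>\<close>, which is 0 in \<^typ>\<open>ereal\<close>, arises only for \<open>\<mu> = 0\<close>. Its value
  does not affect the infimum below: whatever the convention, if the estimate holds with
  \<open>\<mu> = 0\<close>, then it holds with every \<open>\<mu> > 0\<close>.\<close>

definition metrically_regular_around ::
  "('a::metric_space \<Rightarrow> 'b::metric_space set) \<Rightarrow> 'a \<Rightarrow> 'b \<Rightarrow> real \<Rightarrow> bool" where
  "metrically_regular_around G xb zb \<mu> \<longleftrightarrow>
     zb \<in> G xb \<and> 0 \<le> \<mu> \<and>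
     (\<exists>U V. open U \<and> xb \<in> U \<and> open V \<and> zb \<in> V \<and>
        (\<forall>x\<in>U. \<forall>z\<in>V. edist_to x (set_valued_inverse G z) \<le> ereal \<mu> * edist_to z (G x)))"

definition reg :: "('a::metric_space \<Rightarrow> 'b::metric_space set) \<Rightarrow> 'a \<Rightarrow> 'b \<Rightarrow> ereal" where
  "reg G xb zb = (INF \<mu>\<in>{\<mu>. metrically_regular_around G xb zb \<mu>}. ereal \<mu>)"

definition std_simplex :: "(real ^ 'k) set" where
  "std_simplex = {x. (\<Sum>i\<in>UNIV. x $ i) = 1 \<and> (\<forall>i. 0 \<le> x $ i)}"

text \<open>Points of \<open>\<real>\<^sup>m \<times> \<real>\<^sup>n\<close> are pairs; the norm of the product type is the Euclidean one.
  The supremum defining \<open>F\<close> is a maximum, see \<open>nash_F_attained\<close>.\<close>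

definition nash_F :: "real ^ 'n ^ 'm \<Rightarrow> (real ^ 'm) \<times> (real ^ 'n) \<Rightarrow> real" where
  "nash_F A = (\<lambda>(x, y).
     SUP (u, v)\<in>std_simplex \<times> std_simplex. x \<bullet> (A *v v) - u \<bullet> (A *v y))"

definition nash_S :: "real ^ 'n ^ 'm \<Rightarrow> ((real ^ 'm) \<times> (real ^ 'n)) set" where
  "nash_S A = {p \<in> std_simplex \<times> std_simplex. nash_F A p = 0}"

definition nash_kappa :: "real ^ 'n ^ 'm \<Rightarrow> ereal" where
  "nash_kappa A =
     (INF \<kappa>\<in>{\<kappa>. 0 \<le> \<kappa> \<and>
        (\<forall>p\<in>std_simplex \<times> std_simplex. edist_to p (nash_S A) \<le> ereal (\<kappa> * nash_F A p))}.
      ereal \<kappa>)"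

definition nash_Phi :: "real ^ 'n ^ 'm \<Rightarrow> (real ^ 'm) \<times> (real ^ 'n) \<Rightarrow> real set" where
  "nash_Phi A p = (if p \<in> std_simplex \<times> std_simplex then {nash_F A p..} else {})"

lemma std_simplex_nonempty: "(std_simplex :: (real ^ 'k) set) \<noteq> {}"
proof -
  have "axis undefined 1 \<in> (std_simplex :: (real ^ 'k) set)"
    by (simp add: std_simplex_def axis_def)
  then show ?thesis by blast
qed

lemma compact_std_simplex: "compact (std_simplex :: (real ^ 'k) set)"
proof -
  have "closed (std_simplex :: (real ^ 'k) set)"
    unfolding std_simplex_def
    by (intro closed_Collect_conj closed_Collect_all closed_Collect_eq closed_Collect_le
        continuous_intros)
  moreover have "norm x \<le> 1" if "x \<in> (std_simplex :: (real ^ 'k) set)" for x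
    using norm_le_l1_cart[of x] that by (simp add: std_simplex_def)
  then have "bounded (std_simplex :: (real ^ 'k) set)"
    by (auto simp: bounded_iff)
  ultimately show ?thesis
    by (simp add: compact_eq_bounded_closed)
qed

lemma nash_F_attained:
  fixes A :: "real ^ 'n ^ 'm" and x :: "real ^ 'm" and y :: "real ^ 'n"
  shows "\<exists>u\<in>std_simplex. \<exists>v\<in>std_simplex.
    nash_F A (x, y) = x \<bullet> (A *v v) - u \<bullet> (A *v y) \<and>
    (\<forall>u'\<in>std_simplex. \<forall>v'\<in>std_simplex.
       x \<bullet> (A *v v') - u' \<bullet> (A *v y) \<le> nash_F A (x, y))"
proof -
  let ?D = "(std_simplex :: (real ^ 'm) set) \<times> (std_simplex :: (real ^ 'n) set)"
  let ?g = "\<lambda>(u, v). x \<bullet> (A *v v) - u \<bullet> (A *v y)"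
  have "continuous_on ?D ?g"
    unfolding case_prod_unfold
    by (intro continuous_intros
        continuous_on_compose2[OF matrix_vector_mult_linear_continuous_on[of UNIV A]]) auto
  then obtain p where p: "p \<in> ?D" "\<forall>q\<in>?D. ?g q \<le> ?g p"
    using continuous_attains_sup[of ?D ?g] compact_Times compact_std_simplex std_simplex_nonempty
    by (metis Times_empty)
  then have "Sup (?g ` ?D) = ?g p"
    by (intro cSup_eq_maximum) auto
  then have "nash_F A (x, y) = ?g p"
    by (simp add: nash_F_def)
  then show ?thesis
    using p by fastforce
qed

end

theory Submission
  imports Defs
begin

text \<open>Let \<open>D\<close> be compact and convex, \<open>f\<close> convex, continuous and nonnegative on \<open>D\<close>, with zero
  set \<open>S\<close>. If \<open>\<kappa>\<close> is a global error bound, then contracting \<open>x \<in> D\<close> towards a nearest point of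
  \<open>S\<close> by the factor \<open>z / f x\<close> reaches the sublevel set of \<open>z\<close>, by convexity, after a move of
  length at most \<open>\<kappa> (f x - z)\<close>; so \<open>\<kappa>\<close> is a regularity modulus at every point outside \<open>S\<close>.
  Conversely, if every point outside \<open>S\<close> has a modulus below \<open>M\<close>, then a minimizer of
  \<open>q \<mapsto> M f q + |q - p|\<close> over \<open>D\<close> must lie in \<open>S\<close>, since regularity at a point outside \<open>S\<close>
  provides a strict descent; comparing with \<open>q = p\<close> gives the error bound \<open>M\<close> at \<open>p\<close>.\<close>

text \<open>\<open>nash_Phi\<close> for arbitrary \<open>D\<close> and \<open>f\<close>, so that the
  equality can be proved without reference to matrices.\<close>

definition epi_mapping :: "'a set \<Rightarrow> ('a \<Rightarrow> real) \<Rightarrow> 'a \<Rightarrow> real set" where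
  "epi_mapping D f p = (if p \<in> D then {f p..} else {})"

lemma edist_to_le: "c \<in> C \<Longrightarrow> edist_to x C \<le> ereal (dist x c)"
  unfolding edist_to_def by (rule INF_lower)

lemma edist_to_empty [simp]: "edist_to x {} = \<infinity>"
  by (simp add: edist_to_def top_ereal_def)

lemma edist_to_less_obtain:
  assumes "edist_to x C < ereal r"
  obtains c where "c \<in> C" "dist x c < r"
  using assms unfolding edist_to_def INF_less_iff by auto

text \<open>A finite bound rules out the empty set, whose distance is infinite; compactness then
  provides a nearest point.\<close>

lemma edist_to_compact_attained:
  assumes "compact C" "edist_to x C \<le> ereal r"
  obtains c where "c \<in> C" "dist x c \<le> r"
proof -
  have "C \<noteq> {}"
    using assms(2) by auto
  moreover have "continuous_on C (dist x)"
    by (intro continuous_intros)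
  ultimately obtain c where c: "c \<in> C" "\<And>d. d \<in> C \<Longrightarrow> dist x c \<le> dist x d"
    using continuous_attains_inf[OF assms(1)] by blast
  then have "ereal (dist x c) \<le> edist_to x C"
    unfolding edist_to_def by (intro INF_greatest) auto
  with assms(2) c(1) that show thesis
    by (metis ereal_less_eq(3) order_trans)
qed

lemma edist_to_atLeast: "edist_to z {a..} = ereal (max 0 (a - z))" for a z :: real
proof (rule antisym)
  show "edist_to z {a..} \<le> ereal (max 0 (a - z))"
    using edist_to_le[of "max a z" "{a..}" z] by (cases "a \<le> z") (auto simp: dist_real_def)
  show "ereal (max 0 (a - z)) \<le> edist_to z {a..}"
    unfolding edist_to_def by (intro INF_greatest) (auto simp: dist_real_def)
qed

lemma set_valued_inverse_epi_mapping:
  "set_valued_inverse (epi_mapping D f) z = {p \<in> D. f p \<le> z}"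
  by (auto simp: set_valued_inverse_def epi_mapping_def)

lemma reg_nonneg: "0 \<le> reg G x z"
  unfolding reg_def by (rule INF_greatest) (auto simp: metrically_regular_around_def)

lemma reg_less_obtain:
  assumes "reg G x z < ereal M"
  obtains \<mu> where "metrically_regular_around G x z \<mu>" "\<mu> < M"
  using assms unfolding reg_def INF_less_iff by auto

text \<open>Regularity is tested at the point \<open>q\<close> itself and at a level
  \<open>f q - d\<close> slightly below its value. The gap between \<open>\<mu>\<close> and
  \<open>M\<close> makes the estimate strict, so some \<open>w\<close> in the sublevel set meets it
  even if the distance is not attained.\<close>

lemma metrically_regular_descent:
  fixes f :: "'a::metric_space \<Rightarrow> real"
  assumes reg: "metrically_regular_around (epi_mapping D f) q (f q) \<mu>"
    and q: "q \<in> D" and M: "\<mu> < M"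
  obtains w where "w \<in> D" "dist q w < M * (f q - f w)"
proof -
  obtain U V where UV: "q \<in> U" "open V" "f q \<in> V"
    and bound: "\<And>x z. x \<in> U \<Longrightarrow> z \<in> V \<Longrightarrow>
      edist_to x {p \<in> D. f p \<le> z} \<le> ereal \<mu> * edist_to z (epi_mapping D f x)"
    using reg unfolding metrically_regular_around_def set_valued_inverse_epi_mapping by blast
  have \<mu>: "0 \<le> \<mu>"
    using reg by (simp add: metrically_regular_around_def)
  obtain e where e: "e > 0" "ball (f q) e \<subseteq> V"
    using UV openE by blast
  define d where "d = e / 2"
  have d: "d > 0" "f q - d \<in> V"
    using e by (auto simp: d_def dist_real_def subset_iff)
  have "edist_to q {p \<in> D. f p \<le> f q - d} \<le> ereal (\<mu> * d)"
    using bound[OF UV(1) d(2)] q d(1) by (simp add: epi_mapping_def edist_to_atLeast)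
  also have "\<dots> < ereal (M * d)"
    using M d(1) by simp
  finally obtain w where w: "w \<in> D" "f w \<le> f q - d" "dist q w < M * d"
    by (auto elim: edist_to_less_obtain)
  have "M * d \<le> M * (f q - f w)"
    using w(2) \<mu> M by (intro mult_left_mono) auto
  with w that show thesis
    by fastforce
qed

lemma error_bound_of_regularity:
  fixes f :: "'a::metric_space \<Rightarrow> real"
  assumes D: "compact D" and cont: "continuous_on D f"
    and reg: "\<And>q. q \<in> D \<Longrightarrow> f q \<noteq> 0 \<Longrightarrow> reg (epi_mapping D f) q (f q) < ereal M"
    and p: "p \<in> D"
  shows "edist_to p {q \<in> D. f q = 0} \<le> ereal (M * f p)"
proof -
  have "continuous_on D (\<lambda>q. M * f q + dist q p)"
    by (intro continuous_intros cont)
  then obtain q where q: "q \<in> D"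
    and min: "\<And>w. w \<in> D \<Longrightarrow> M * f q + dist q p \<le> M * f w + dist w p"
    using continuous_attains_inf[OF D] p by blast
  have "f q = 0"
  proof (rule ccontr)
    assume "f q \<noteq> 0"
    then obtain \<mu> where \<mu>: "metrically_regular_around (epi_mapping D f) q (f q) \<mu>" "\<mu> < M"
      using reg q reg_less_obtain by metis
    obtain w where w: "w \<in> D" "dist q w < M * (f q - f w)"
      using metrically_regular_descent[OF \<mu>(1) q \<mu>(2)] .
    \<comment> \<open>Moving from \<open>q\<close> to \<open>w\<close> lengthens the distance to
      \<open>p\<close> by at most \<open>dist q w\<close>, which is less than the gain
      \<open>M * (f q - f w)\<close>; this contradicts minimality.\<close>
    with min[OF w(1)] dist_triangle[of w p q] show False
      by (simp add: algebra_simps dist_commute)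
  qed
  then have "edist_to p {q \<in> D. f q = 0} \<le> ereal (dist p q)"
    using q by (intro edist_to_le) simp
  also have "dist p q \<le> M * f p"
    using min[OF p] \<open>f q = 0\<close> by (simp add: dist_commute)
  finally show ?thesis
    by simp
qed

lemma regularity_of_error_bound:
  fixes f :: "'a::real_normed_vector \<Rightarrow> real"
  assumes D: "compact D" and cvx: "convex_on D f" and cont: "continuous_on D f"
    and nonneg: "\<And>q. q \<in> D \<Longrightarrow> 0 \<le> f q" and k: "0 \<le> k"
    and bound: "\<And>q. q \<in> D \<Longrightarrow> edist_to q {q \<in> D. f q = 0} \<le> ereal (k * f q)"
    and p: "p \<in> D" "f p \<noteq> 0"
  shows "metrically_regular_around (epi_mapping D f) p (f p) k"
proof -
  let ?S = "{q \<in> D. f q = 0}"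
  have S: "compact ?S"
  proof -
    have "closed ?S"
      using continuous_closed_preimage_constant[OF cont compact_imp_closed[OF D]] .
    then show ?thesis
      using compact_Int_closed[OF D, of ?S] by (simp add: Int_absorb1 Collect_conj_eq)
  qed
  \<comment> \<open>Outside \<open>D\<close> the right-hand side of the estimate is \<open>k\<close>
    times infinity, which would be 0 for \<open>k = 0\<close>.\<close>
  have "k \<noteq> 0"
  proof
    assume "k = 0"
    then obtain s where "s \<in> ?S" "dist p s \<le> 0"
      using edist_to_compact_attained[OF S, of p 0] bound[OF p(1)] by auto
    with p(2) show False
      by auto
  qed
  with k have k: "0 < k"
    by simp
  \<comment> \<open>The estimate is global in \<open>x\<close> and holds at all positive levels, so
    the neighbourhoods can be the whole space and the positive half-line.\<close>
  have est: "edist_to x {q \<in> D. f q \<le> z} \<le> ereal k * edist_to z (epi_mapping D f x)"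
    if z: "0 < z" for x z
  proof (cases "x \<in> D")
    case False
    then show ?thesis
      using k by (simp add: epi_mapping_def)
  next
    case x: True
    show ?thesis
    proof (cases "f x \<le> z")
      case True
      then have "edist_to x {q \<in> D. f q \<le> z} \<le> ereal (dist x x)"
        using x by (intro edist_to_le) simp
      then show ?thesis
        using True x by (simp add: epi_mapping_def edist_to_atLeast)
    next
      case False
      obtain s where s: "s \<in> D" "f s = 0" "dist x s \<le> k * f x"
        using edist_to_compact_attained[OF S bound[OF x]] by blast
      \<comment> \<open>Since \<open>f s = 0\<close>, convexity bounds \<open>f w\<close> by
        \<open>t * f x\<close>; this choice of \<open>t\<close> makes that bound equal to
        \<open>z\<close>.\<close>
      define t where "t = z / f x"
      have t: "0 \<le> t" "t \<le> 1" "t * f x = z"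
        using False z by (auto simp: t_def field_simps)
      define w where "w = (1 - t) *\<^sub>R s + t *\<^sub>R x"
      have "w \<in> D"
        using convexD_alt[OF convex_on_imp_convex[OF cvx] s(1) x t(1,2)] by (simp add: w_def)
      moreover have "f w \<le> z"
        using convex_onD[OF cvx t(1,2) s(1) x] s(2) t(3) by (simp add: w_def)
      moreover have "x - w = (1 - t) *\<^sub>R (x - s)"
        by (simp add: w_def algebra_simps)
      then have "dist x w = (1 - t) * dist x s"
        using t(2) by (simp add: dist_norm)
      then have "dist x w \<le> k * (f x - z)"
        using mult_left_mono[OF s(3), of "1 - t"] t(2) unfolding t(3)[symmetric]
        by (simp add: algebra_simps)
      ultimately have "edist_to x {q \<in> D. f q \<le> z} \<le> ereal (k * (f x - z))"
        using edist_to_le[of w "{q \<in> D. f q \<le> z}" x] by (auto intro: order_trans)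
      then show ?thesis
        using False x by (simp add: epi_mapping_def edist_to_atLeast)
    qed
  qed
  have "0 < f p"
    using nonneg[OF p(1)] p(2) by simp
  moreover have "f p \<in> epi_mapping D f p"
    using p(1) by (simp add: epi_mapping_def)
  ultimately show ?thesis
    unfolding metrically_regular_around_def set_valued_inverse_epi_mapping
    using est k by (auto intro!: exI[of _ UNIV] exI[of _ "{0<..}"])
qed

theorem error_bound_eq_SUP_reg:
  fixes f :: "'a::real_normed_vector \<Rightarrow> real"
  assumes D: "compact D" and cvx: "convex_on D f" and cont: "continuous_on D f"
    and nonneg: "\<And>q. q \<in> D \<Longrightarrow> 0 \<le> f q"
    and S: "S = {q \<in> D. f q = 0}" and ne: "D - S \<noteq> {}"
  shows "(INF k\<in>{k. 0 \<le> k \<and> (\<forall>p\<in>D. edist_to p S \<le> ereal (k * f p))}. ereal k) =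
    (SUP p\<in>D - S. reg (epi_mapping D f) p (f p))"
    (is "?kappa = ?sup")
proof (rule antisym)
  show "?sup \<le> ?kappa"
  proof (intro SUP_least INF_greatest)
    fix p k
    assume "p \<in> D - S" "k \<in> {k. 0 \<le> k \<and> (\<forall>p\<in>D. edist_to p S \<le> ereal (k * f p))}"
    then have "metrically_regular_around (epi_mapping D f) p (f p) k"
      by (intro regularity_of_error_bound[OF D cvx cont nonneg]) (auto simp: S)
    then show "reg (epi_mapping D f) p (f p) \<le> ereal k"
      unfolding reg_def by (intro INF_lower) simp
  qed
  show "?kappa \<le> ?sup"
  proof (rule dense_ge)
    fix y assume y: "?sup < y"
    \<comment> \<open>Here \<open>ne\<close> enters: over an empty index set the supremum in
      \<open>ereal\<close> would be minus infinity.\<close>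
    have "0 \<le> ?sup"
      using ne reg_nonneg by (meson SUP_upper2 ex_in_conv)
    with y have "0 < y"
      by simp
    show "?kappa \<le> y"
    proof (cases y)
      case (real M)
      have "edist_to p {q \<in> D. f q = 0} \<le> ereal (M * f p)" if "p \<in> D" for p
      proof (rule error_bound_of_regularity[OF D cont _ that])
        show "reg (epi_mapping D f) q (f q) < ereal M" if "q \<in> D" "f q \<noteq> 0" for q
          using SUP_lessD[OF y, of q] that real by (simp add: S)
      qed
      then show ?thesis
        using \<open>0 < y\<close> unfolding real S by (intro INF_lower) simp
    qed (use \<open>0 < y\<close> in auto)
  qed
qed

text \<open>A maximum of functions affine in \<open>(x, y)\<close>: a maximizer at the convex
  combination competes at both endpoints. Taking \<open>UNIV\<close> as the domain also yields
  continuity, as finite convex functions on open finite-dimensional sets are continuous.\<close>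

lemma nash_F_convex:
  fixes A :: "real ^ 'n ^ 'm"
  shows "convex_on UNIV (nash_F A)"
proof (rule convex_onI)
  fix t :: real and p q :: "(real ^ 'm) \<times> (real ^ 'n)"
  assume t: "0 < t" "t < 1"
  obtain x y x' y' where pq: "p = (x, y)" "q = (x', y')"
    by (metis surj_pair)
  define a b where "a = (1 - t) *\<^sub>R x + t *\<^sub>R x'" and "b = (1 - t) *\<^sub>R y + t *\<^sub>R y'"
  obtain u v where uv: "u \<in> std_simplex" "v \<in> std_simplex"
    and F: "nash_F A (a, b) = a \<bullet> (A *v v) - u \<bullet> (A *v b)"
    using nash_F_attained by metis
  have "a \<bullet> (A *v v) - u \<bullet> (A *v b) = (1 - t) * (x \<bullet> (A *v v) - u \<bullet> (A *v y))
      + t * (x' \<bullet> (A *v v) - u \<bullet> (A *v y'))"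
    unfolding a_def b_def
    by (simp add: matrix_vector_right_distrib matrix_vector_mult_scaleR inner_add_left
        inner_add_right algebra_simps)
  also have "\<dots> \<le> (1 - t) * nash_F A (x, y) + t * nash_F A (x', y')"
    using nash_F_attained[of A x y] nash_F_attained[of A x' y'] uv t
    by (intro add_mono mult_left_mono) auto
  finally show "nash_F A ((1 - t) *\<^sub>R p + t *\<^sub>R q) \<le> (1 - t) * nash_F A p + t * nash_F A q"
    using F by (simp add: pq a_def b_def)
qed simp

text \<open>Answering \<open>(x, y)\<close> with \<open>u = x\<close> and \<open>v = y\<close> makes
  the two payoffs cancel.\<close>

lemma nash_F_nonneg:
  assumes "p \<in> std_simplex \<times> std_simplex"
  shows "0 \<le> nash_F A p"
proof -
  obtain x y where p: "p = (x, y)" "x \<in> std_simplex" "y \<in> std_simplex"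
    using assms by auto
  then have "x \<bullet> (A *v y) - x \<bullet> (A *v y) \<le> nash_F A (x, y)"
    using nash_F_attained[of A x y] by blast
  with p(1) show ?thesis
    by simp
qed

lemma convex_std_simplex: "convex std_simplex"
  unfolding convex_def std_simplex_def
  by (auto simp: sum.distrib simp flip: sum_distrib_left)

theorem theorem1p1:
  fixes A :: "real ^ 'n ^ 'm"
  assumes "std_simplex \<times> std_simplex - nash_S A \<noteq> {}"
  shows "nash_kappa A =
    (SUP p\<in>std_simplex \<times> std_simplex - nash_S A. reg (nash_Phi A) p (nash_F A p))"
proof -
  let ?D = "(std_simplex :: (real ^ 'm) set) \<times> (std_simplex :: (real ^ 'n) set)"
  have "convex_on ?D (nash_F A)"
    using convex_on_subset[OF nash_F_convex _ convex_Times[OF convex_std_simplex convex_std_simplex]]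
    by blast
  moreover have "continuous_on ?D (nash_F A)"
    using convex_on_continuous[OF open_UNIV nash_F_convex] continuous_on_subset by blast
  moreover have "nash_Phi A = epi_mapping ?D (nash_F A)"
    by (simp add: fun_eq_iff nash_Phi_def epi_mapping_def)
  ultimately show ?thesis
    unfolding nash_kappa_def
    using error_bound_eq_SUP_reg[OF compact_Times[OF compact_std_simplex compact_std_simplex]
        _ _ nash_F_nonneg nash_S_def assms]
    by simp
qed

end
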